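(* Let $X$ be a $T_0$ space. If $X$ is sober then $X$ is a $\mathsf{DC}$ space; if $X$ is a $\mathsf{DC}$ space then $X$ is a Rudin space; and if $X$ is a Rudin space then $X$ is a well-filtered determined ($\mathsf{WD}$) space.
   Context: For a $T_0$ space $X$, the specialization order is $x\le y$ iff $x\in\overline{\{y\}}$; order notions refer to it. A nonempty subset $A$ is irreducible if whenever $A\subseteq F_1\cup F_2$ with $F_1,F_2$ closed, then $A\subseteq F_1$ or $A\subseteq F_2$. $X$ is sober if every irreducible closed set is $\overline{\{a\}}$ for a unique $a\in X$. $\mathsf{K}(X)$ is the set of nonempty compact saturated subsets (saturated = upper set in the specialization order). A family $\mathcal K\subseteq \mathsf K(X)$ is filtered if it is nonempty and for all $K_1,K_2\in\mathcal K$ there is $K_3\in\mathcal K$ with $K_3\subseteq K_1\cap K_2$. A space $Y$ is well-filtered if it is $T_0$ and for every open $U\subseteq Y$ and every filtered family $\mathcal K\subseteq\mathsf K(Y)$, $\bigcap\mathcal K\subseteq U$ implies $K\subseteq U$ for some $K\in\mathcal K$. $X$ is a $\mathsf{DC}$ space (directed closure space) if every irreducible closed subset of $X$ is the closure of a directed subset of $X$. A Rudin set is a nonempty closed subset $A$ of $X$ for which there is a filtered family $\mathcal K\subseteq\mathsf K(X)$ such that $A$ is minimal (under inclusion) among the closed subsets of $X$ that meet every member of $\mathcal K$; $X$ is a Rudin space if every irreducible closed subset of $X$ is a Rudin set. A subset $A\subseteq X$ is well-filtered determined if for every continuous map $f:X\to Y$ to a well-filtered space $Y$ there is a unique $y_A\in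 Y$ with $\overline{f(A)}=\overline{\{y_A\}}$; $X$ is a well-filtered determined space ($\mathsf{WD}$ space) if every irreducible closed subset of $X$ is well-filtered determined. *)

theory Defs
  imports "HOL-Analysis.Analysis"
begin

text \<open>Since \<^term>\<open>X closure_of {y} = {}\<close> for \<^term>\<open>y \<notin> topspace X\<close>, the relation below
  only relates points of the space.\<close>

definition spec_le :: "'a topology \<Rightarrow> 'a \<Rightarrow> 'a \<Rightarrow> bool" where
  "spec_le X x y \<longleftrightarrow> x \<in> X closure_of {y}"

definition irreducible_in :: "'a topology \<Rightarrow> 'a set \<Rightarrow> bool" where
  "irreducible_in X A \<longleftrightarrow> A \<subseteq> topspace X \<and> A \<noteq> {} \<and>
     (\<forall>F1 F2. closedin X F1 \<longrightarrow> closedin X F2 \<longrightarrow> A \<subseteq> F1 \<union> F2 \<longrightarrow> A \<subseteq> F1 \<or> A \<subseteq> F2)"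

definition sober_space :: "'a topology \<Rightarrow> bool" where
  "sober_space X \<longleftrightarrow>
     (\<forall>A. closedin X A \<longrightarrow> irreducible_in X A \<longrightarrow> (\<exists>!a. a \<in> topspace X \<and> A = X closure_of {a}))"

definition saturated_in :: "'a topology \<Rightarrow> 'a set \<Rightarrow> bool" where
  "saturated_in X K \<longleftrightarrow> K \<subseteq> topspace X \<and> (\<forall>x\<in>K. \<forall>y. spec_le X x y \<longrightarrow> y \<in> K)"

definition compact_saturated_sets :: "'a topology \<Rightarrow> 'a set set" where
  "compact_saturated_sets X = {K. K \<noteq> {} \<and> compactin X K \<and> saturated_in X K}"

definition filtered_family :: "'a set set \<Rightarrow> bool" where
  "filtered_family \<K> \<longleftrightarrow> \<K> \<noteq> {} \<and> (\<forall>K1\<in>\<K>. \<forall>K2\<in>\<K>. \<exists>K3\<in>\<K>. K3 \<subseteq> K1 \<inter> K2)"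

definition well_filtered_space :: "'a topology \<Rightarrow> bool" where
  "well_filtered_space Y \<longleftrightarrow> t0_space Y \<and>
     (\<forall>U \<K>. openin Y U \<longrightarrow> \<K> \<subseteq> compact_saturated_sets Y \<longrightarrow> filtered_family \<K> \<longrightarrow>
        \<Inter>\<K> \<subseteq> U \<longrightarrow> (\<exists>K\<in>\<K>. K \<subseteq> U))"

definition directed_in :: "'a topology \<Rightarrow> 'a set \<Rightarrow> bool" where
  "directed_in X D \<longleftrightarrow> D \<subseteq> topspace X \<and> D \<noteq> {} \<and>
     (\<forall>x\<in>D. \<forall>y\<in>D. \<exists>z\<in>D. spec_le X x z \<and> spec_le X y z)"

definition DC_space :: "'a topology \<Rightarrow> bool" where
  "DC_space X \<longleftrightarrow>
     (\<forall>A. closedin X A \<longrightarrow> irreducible_in X A \<longrightarrow> (\<exists>D. directed_in X D \<and> A = X closure_of D))"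

definition closed_meeting :: "'a topology \<Rightarrow> 'a set set \<Rightarrow> 'a set set" where
  "closed_meeting X \<K> = {B. closedin X B \<and> (\<forall>K\<in>\<K>. B \<inter> K \<noteq> {})}"

definition Rudin_set :: "'a topology \<Rightarrow> 'a set \<Rightarrow> bool" where
  "Rudin_set X A \<longleftrightarrow> A \<noteq> {} \<and> closedin X A \<and>
     (\<exists>\<K> \<subseteq> compact_saturated_sets X. filtered_family \<K> \<and>
        A \<in> closed_meeting X \<K> \<and> (\<forall>B \<in> closed_meeting X \<K>. B \<subseteq> A \<longrightarrow> B = A))"

definition Rudin_space :: "'a topology \<Rightarrow> bool" where
  "Rudin_space X \<longleftrightarrow> (\<forall>A. closedin X A \<longrightarrow> irreducible_in X A \<longrightarrow> Rudin_set X A)"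

text \<open>HOL cannot quantify over all spaces \<open>Y\<close> inside a definition, so the type of the points
  of \<open>Y\<close> is a parameter. In the conclusion of a theorem with \<open>'b\<close> free, the property is
  asserted for every type \<open>'b\<close>, hence for all target spaces.\<close>

definition well_filtered_determined :: "'b itself \<Rightarrow> 'a topology \<Rightarrow> 'a set \<Rightarrow> bool" where
  "well_filtered_determined (_ :: 'b itself) X A \<longleftrightarrow> A \<subseteq> topspace X \<and>
     (\<forall>(Y :: 'b topology) f. well_filtered_space Y \<longrightarrow> continuous_map X Y f \<longrightarrow>
        (\<exists>!y. y \<in> topspace Y \<and> Y closure_of (f ` A) = Y closure_of {y}))"

definition WD_space :: "'b itself \<Rightarrow> 'a topology \<Rightarrow> bool" where
  "WD_space (T :: 'b itself) X \<longleftrightarrow>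
     (\<forall>A. closedin X A \<longrightarrow> irreducible_in X A \<longrightarrow> well_filtered_determined T X A)"

end

theory Submission
  imports Defs
begin

text \<open>A sober space is DC because singletons are directed. If a closed set is the closure of a
  directed set \<open>D\<close>, then it is minimal among the closed sets meeting the principal upper sets of
  the points of \<open>D\<close>, since closed sets are lower sets. Finally, let \<open>A\<close> be minimal among the closed
  sets meeting every member of a filtered family \<open>\<K>\<close>, and let \<open>f\<close> map continuously into a
  well-filtered space. The upper closures of \<open>f ` (K \<inter> A)\<close> form a filtered family, so their
  intersection meets the closure of \<open>f ` A\<close> in some point \<open>y\<close>. The part of \<open>A\<close> that \<open>f\<close> maps into
  the closure of \<open>{y}\<close> is closed and still meets every \<open>K\<close>, so it is all of \<open>A\<close> by minimality.\<close>

section \<open>The specialization order\<close>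

lemma spec_le_in_topspace:
  assumes "spec_le X x y"
  shows "x \<in> topspace X" "y \<in> topspace X"
  using assms unfolding spec_le_def in_closure_of by blast+

lemma spec_le_refl: "x \<in> topspace X \<Longrightarrow> spec_le X x x"
  unfolding spec_le_def in_closure_of by simp

lemma spec_le_openin: "spec_le X x y \<Longrightarrow> openin X U \<Longrightarrow> x \<in> U \<Longrightarrow> y \<in> U"
  unfolding spec_le_def in_closure_of by blast

lemma spec_le_closedin: "spec_le X x y \<Longrightarrow> closedin X C \<Longrightarrow> y \<in> C \<Longrightarrow> x \<in> C"
  unfolding spec_le_def using closure_of_minimal[of "{y}" C X] by blast

text \<open>The closure of \<open>{z}\<close> is closed and contains \<open>y\<close>; closed sets
  are lower sets, so it contains \<open>x\<close>.\<close>

lemma spec_le_trans: "spec_le X x y \<Longrightarrow> spec_le X y z \<Longrightarrow> spec_le X x z"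
  by (metis closedin_closure_of spec_le_closedin spec_le_def)

text \<open>Each point lies below the other, so no open set separates them. Needed for the
  uniqueness of the point in \<open>well_filtered_determined\<close>.\<close>

lemma t0_space_closure_of_singleton_eqD:
  assumes "t0_space X" "x \<in> topspace X" "y \<in> topspace X"
    and "X closure_of {x} = X closure_of {y}"
  shows "x = y"
proof -
  have "spec_le X x y" "spec_le X y x"
    using assms spec_le_refl unfolding spec_le_def by metis+
  then have "x \<in> U \<longleftrightarrow> y \<in> U" if "openin X U" for U
    using that spec_le_openin by metis
  then show ?thesis
    using assms(1-3) unfolding t0_space_def by blast
qed

section \<open>Saturations and filtered families\<close>

text \<open>The saturation: for \<open>S\<close> inside the space, the intersection of all open sets
  containing \<open>S\<close>.\<close>

definition upper_closure :: "'a topology \<Rightarrow> 'a set \<Rightarrow> 'a set" where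
  "upper_closure X S = {y. \<exists>x\<in>S. spec_le X x y}"

lemma upper_closure_mono: "S \<subseteq> T \<Longrightarrow> upper_closure X S \<subseteq> upper_closure X T"
  unfolding upper_closure_def by blast

lemma subset_upper_closure: "S \<subseteq> topspace X \<Longrightarrow> S \<subseteq> upper_closure X S"
  unfolding upper_closure_def using spec_le_refl by fastforce

lemma upper_closure_subset_topspace: "upper_closure X S \<subseteq> topspace X"
  unfolding upper_closure_def using spec_le_in_topspace by fast

lemma saturated_in_upper_closure: "saturated_in X (upper_closure X S)"
  unfolding saturated_in_def using upper_closure_subset_topspace[of X S]
  by (auto simp: upper_closure_def intro: spec_le_trans)

lemma upper_closure_subset_openin: "openin X U \<Longrightarrow> S \<subseteq> U \<Longrightarrow> upper_closure X S \<subseteq> U"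
  unfolding upper_closure_def using spec_le_openin by fastforce

text \<open>Open sets are upper sets, so a finite subcover of \<open>S\<close> already covers its
  saturation.\<close>

lemma compactin_upper_closure:
  assumes "compactin X S"
  shows "compactin X (upper_closure X S)"
  unfolding compactin_def
proof (intro conjI allI impI)
  show "upper_closure X S \<subseteq> topspace X"
    by (rule upper_closure_subset_topspace)
  fix \<U> assume \<U>: "Ball \<U> (openin X) \<and> upper_closure X S \<subseteq> \<Union>\<U>"
  then have "S \<subseteq> \<Union>\<U>"
    using subset_upper_closure[OF compactin_subset_topspace[OF assms]] by blast
  then obtain \<F> where "finite \<F>" "\<F> \<subseteq> \<U>" "S \<subseteq> \<Union>\<F>"
    using assms \<U> unfolding compactin_def by meson
  moreover from this have "openin X (\<Union>\<F>)"
    using \<U> by blast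
  ultimately show "\<exists>\<F>. finite \<F> \<and> \<F> \<subseteq> \<U> \<and> upper_closure X S \<subseteq> \<Union>\<F>"
    using upper_closure_subset_openin by meson
qed

lemma upper_closure_in_compact_saturated_sets:
  assumes "compactin X S" "S \<noteq> {}"
  shows "upper_closure X S \<in> compact_saturated_sets X"
proof -
  have "S \<subseteq> upper_closure X S"
    using subset_upper_closure[OF compactin_subset_topspace[OF assms(1)]] .
  then show ?thesis
    using assms(2) compactin_upper_closure[OF assms(1)] saturated_in_upper_closure[of X S]
    by (auto simp: compact_saturated_sets_def)
qed

lemma filtered_family_image:
  assumes "filtered_family \<K>" and "\<And>K L. K \<in> \<K> \<Longrightarrow> L \<in> \<K> \<Longrightarrow> K \<subseteq> L \<Longrightarrow> g K \<subseteq> g L"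
  shows "filtered_family (g ` \<K>)"
proof -
  have "\<exists>M\<in>\<K>. g M \<subseteq> g K \<inter> g L" if KL: "K \<in> \<K>" "L \<in> \<K>" for K L
  proof -
    obtain M where "M \<in> \<K>" "M \<subseteq> K \<inter> L"
      using assms(1) KL unfolding filtered_family_def by meson
    then show ?thesis
      using assms(2)[of M K] assms(2)[of M L] KL by blast
  qed
  then show ?thesis
    using assms(1) unfolding filtered_family_def by simp
qed

section \<open>The three implications\<close>

lemma sober_imp_DC_space:
  assumes "sober_space X"
  shows "DC_space X"
  unfolding DC_space_def
proof (intro allI impI)
  fix A assume "closedin X A" "irreducible_in X A"
  then obtain a where "a \<in> topspace X" "A = X closure_of {a}"
    using assms unfolding sober_space_def by meson
  moreover from this have "directed_in X {a}"
    unfolding directed_in_def by (simp add: spec_le_refl)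
  ultimately show "\<exists>D. directed_in X D \<and> A = X closure_of D"
    by blast
qed

lemma Rudin_set_closure_of_directed:
  assumes D: "directed_in X D"
  shows "Rudin_set X (X closure_of D)"
proof -
  let ?A = "X closure_of D"
  let ?\<K> = "(\<lambda>d. upper_closure X {d}) ` D"
  have Dtop: "D \<subseteq> topspace X" and "D \<noteq> {}"
    using D unfolding directed_in_def by auto
  have DA: "D \<subseteq> ?A"
    using closure_of_subset[OF Dtop] .
  have up: "upper_closure X {d} \<in> compact_saturated_sets X" "d \<in> upper_closure X {d}"
    if "d \<in> D" for d
    using that Dtop upper_closure_in_compact_saturated_sets[of X "{d}"]
      subset_upper_closure[of "{d}" X] by auto
  have filt: "filtered_family ?\<K>"
    unfolding filtered_family_def
  proof (intro conjI ballI)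
    show "?\<K> \<noteq> {}"
      using \<open>D \<noteq> {}\<close> by blast
    fix K1 K2 assume "K1 \<in> ?\<K>" "K2 \<in> ?\<K>"
    then obtain x y where xy: "x \<in> D" "y \<in> D"
      "K1 = upper_closure X {x}" "K2 = upper_closure X {y}"
      by blast
    then obtain z where "z \<in> D" "spec_le X x z" "spec_le X y z"
      using D unfolding directed_in_def by meson
    then show "\<exists>K3\<in>?\<K>. K3 \<subseteq> K1 \<inter> K2"
      using xy unfolding upper_closure_def by (auto intro!: bexI[of _ z] intro: spec_le_trans)
  qed
  have meet: "?A \<in> closed_meeting X ?\<K>"
    unfolding closed_meeting_def using up(2) DA by auto
  have "B = ?A" if B: "B \<in> closed_meeting X ?\<K>" "B \<subseteq> ?A" for B
  proof -
    have cl: "closedin X B"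
      using B(1) unfolding closed_meeting_def by blast
    \<comment> \<open>\<open>B\<close> meets the principal upper set of \<open>d\<close> in some
      \<open>b\<close> above \<open>d\<close>, and \<open>B\<close> is a lower set. Then
      \<open>B\<close> contains \<open>D\<close>, hence its closure.\<close>
    have "d \<in> B" if "d \<in> D" for d
    proof -
      obtain b where "b \<in> B" "spec_le X d b"
        using B(1) \<open>d \<in> D\<close> unfolding closed_meeting_def upper_closure_def by blast
      then show ?thesis
        using cl spec_le_closedin[of X d b B] by blast
    qed
    then show ?thesis
      using closure_of_minimal[of D B X] cl B(2) by blast
  qed
  moreover have "?A \<noteq> {}"
    using DA \<open>D \<noteq> {}\<close> by blast
  moreover have "?\<K> \<subseteq> compact_saturated_sets X"
    using up(1) by blast
  ultimately show ?thesis
    unfolding Rudin_set_def using filt meet by (auto intro!: exI[of _ ?\<K>])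
qed

lemma DC_imp_Rudin_space: "DC_space X \<Longrightarrow> Rudin_space X"
  unfolding DC_space_def Rudin_space_def using Rudin_set_closure_of_directed by fast

lemma closure_of_image_Rudin_set:
  assumes A: "Rudin_set X A" and Y: "well_filtered_space Y" and f: "continuous_map X Y f"
  obtains y where "y \<in> topspace Y" "Y closure_of (f ` A) = Y closure_of {y}"
proof -
  have clA: "closedin X A"
    using A unfolding Rudin_set_def by blast
  obtain \<K> where \<K>: "\<K> \<subseteq> compact_saturated_sets X" "filtered_family \<K>"
      "A \<in> closed_meeting X \<K>"
    and minA: "\<And>B. B \<in> closed_meeting X \<K> \<Longrightarrow> B \<subseteq> A \<Longrightarrow> B = A"
    using A unfolding Rudin_set_def by blast
  \<comment> \<open>Cutting \<open>K\<close> down to \<open>A\<close> first keeps the preimages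
    found later inside \<open>A\<close>; saturating is needed because a continuous image need not be
    an upper set.\<close>
  let ?g = "\<lambda>K. upper_closure Y (f ` (A \<inter> K))"
  have fA: "f ` A \<subseteq> topspace Y"
    using f closedin_subset[OF clA] unfolding continuous_map_def by blast
  have ne: "A \<inter> K \<noteq> {}" if K: "K \<in> \<K>" for K
    using K \<K>(3) unfolding closed_meeting_def by blast
  have gK: "?g K \<in> compact_saturated_sets Y" if K: "K \<in> \<K>" for K
  proof (rule upper_closure_in_compact_saturated_sets)
    have "compactin X K"
      using \<K>(1) K unfolding compact_saturated_sets_def by blast
    then show "compactin Y (f ` (A \<inter> K))"
      using clA f closed_Int_compactin image_compactin by metis
    show "f ` (A \<inter> K) \<noteq> {}"
      using ne[OF K] by blast
  qed
  have "filtered_family (?g ` \<K>)"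
    using \<K>(2) by (rule filtered_family_image) (auto intro!: upper_closure_mono)
  moreover have "?g ` \<K> \<subseteq> compact_saturated_sets Y"
    using gK by blast
  moreover have "\<not> ?g K \<subseteq> topspace Y - Y closure_of (f ` A)" if K: "K \<in> \<K>" for K
  proof -
    obtain k where "k \<in> A \<inter> K"
      using ne[OF K] by blast
    then have "f k \<in> ?g K" "f k \<in> Y closure_of (f ` A)"
      using subset_upper_closure[of "f ` (A \<inter> K)" Y] closure_of_subset[OF fA] fA by blast+
    then show ?thesis
      by blast
  qed
  ultimately have "\<not> \<Inter>(?g ` \<K>) \<subseteq> topspace Y - Y closure_of (f ` A)"
    using Y openin_diff[OF openin_topspace closedin_closure_of, of Y "f ` A"]
    unfolding well_filtered_space_def by (metis (no_types, lifting) imageE)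
  \<comment> \<open>Guarantees that a point of the intersection outside that open set lies in the
    closure; an empty family would have intersection \<open>UNIV\<close>.\<close>
  moreover have "\<Inter>(?g ` \<K>) \<subseteq> topspace Y"
    using \<K>(2) upper_closure_subset_topspace unfolding filtered_family_def by fast
  ultimately obtain y where y: "\<And>K. K \<in> \<K> \<Longrightarrow> y \<in> ?g K" "y \<in> Y closure_of (f ` A)"
    by blast
  have ytop: "y \<in> topspace Y"
    using y(2) in_closure_of by fast
  let ?B = "A \<inter> {x \<in> topspace X. f x \<in> Y closure_of {y}}"
  have "?B \<inter> K \<noteq> {}" if K: "K \<in> \<K>" for K
  proof -
    \<comment> \<open>By definition of the order, \<open>f k\<close> below \<open>y\<close> means
      that \<open>f k\<close> is in the closure of \<open>{y}\<close>, so \<open>k\<close> witnesses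
      that \<open>?B\<close> meets \<open>K\<close>.\<close>
    obtain k where "k \<in> A \<inter> K" "spec_le Y (f k) y"
      using y(1)[OF K] unfolding upper_closure_def by blast
    then show ?thesis
      using closedin_subset[OF clA] unfolding spec_le_def by blast
  qed
  moreover have "closedin X ?B"
    using clA closedin_continuous_map_preimage[OF f closedin_closure_of] by (rule closedin_Int)
  ultimately have "?B = A"
    by (intro minA) (auto simp: closed_meeting_def)
  then have "f ` A \<subseteq> Y closure_of {y}"
    by blast
  then have "Y closure_of (f ` A) \<subseteq> Y closure_of {y}"
    by (simp add: closure_of_minimal)
  moreover have "Y closure_of {y} \<subseteq> Y closure_of (f ` A)"
    using y(2) by (simp add: closure_of_minimal)
  ultimately show thesis
    using that ytop by blast
qed

lemma Rudin_set_imp_well_filtered_determined: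
  assumes "Rudin_set X A"
  shows "well_filtered_determined TYPE('b) X A"
  unfolding well_filtered_determined_def
proof (intro conjI allI impI)
  show "A \<subseteq> topspace X"
    using assms closedin_subset unfolding Rudin_set_def by blast
  fix Y :: "'b topology" and f
  assume Y: "well_filtered_space Y" and f: "continuous_map X Y f"
  obtain y where "y \<in> topspace Y" "Y closure_of (f ` A) = Y closure_of {y}"
    using closure_of_image_Rudin_set[OF assms Y f] .
  \<comment> \<open>Well-filtered spaces are T0 by definition, which makes \<open>y\<close>
    unique.\<close>
  moreover have "t0_space Y"
    using Y unfolding well_filtered_space_def by blast
  ultimately show "\<exists>!y. y \<in> topspace Y \<and> Y closure_of (f ` A) = Y closure_of {y}"
    using t0_space_closure_of_singleton_eqD by metis
qed

lemma Rudin_imp_WD_space: "Rudin_space X \<Longrightarrow> WD_space TYPE('b) X"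
  by (simp add: Rudin_space_def WD_space_def Rudin_set_imp_well_filtered_determined)

theorem corollary6p3:
  fixes X :: "'a topology"
  assumes "t0_space X"
  shows "(sober_space X \<longrightarrow> DC_space X) \<and>
         (DC_space X \<longrightarrow> Rudin_space X) \<and>
         (Rudin_space X \<longrightarrow> WD_space TYPE('b) X)"
  by (simp add: sober_imp_DC_space DC_imp_Rudin_space Rudin_imp_WD_space)

end
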